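(* Let $A=M-N$ be a weak proper splitting of the second type of a singular matrix $A\in\mathbb{R}^{n\times n}$. For $\lambda>0$, let $B_\lambda=A^TA+\lambda I$ and let $B_\lambda=M_\lambda-N_\lambda$ be a weak splitting of the second type of $B_\lambda\in\mathbb{R}^{n\times n}$. If $NA^\dagger\ge\lim_{\lambda\to 0}N_\lambda B_\lambda^{-1}\ge 0$, then $$\lim_{\lambda\to 0}\rho(M_\lambda^{-1}N_\lambda)\le\rho(M^\dagger N)<1.$$
   Context: Matrix inequalities are entrywise. $X^\dagger$ is the Moore-Penrose inverse, $\rho$ the spectral radius. A decomposition $A=M-N$ of a real matrix $A$ is a proper splitting if $A$ and $M$ have the same range and the same null space; it is a weak proper splitting of the second type if moreover $NM^\dagger\ge 0$. For nonsingular $B\in\mathbb{R}^{n\times n}$, a decomposition $B=U-V$ with $U$ nonsingular is a weak splitting of the second type if $VU^{-1}\ge 0$. $\lim_{\lambda\to0}$ denotes the limit as $\lambda\to 0$ through positive values (entrywise for matrices). *)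

theory Defs
  imports "HOL-Analysis.Analysis"
begin

text \<open>
  Matrix inequalities are entrywise: the library order on \<^typ>\<open>real^'n\<close> is componentwise,
  hence on \<^typ>\<open>real^'n^'m\<close> it is entrywise. Likewise the topology on matrices is the
  product one, so matrix limits are entrywise limits.
\<close>

text \<open>The four Penrose equations determine the inverse uniquely.\<close>

definition is_mp_inverse :: "real^'n^'m \<Rightarrow> real^'m^'n \<Rightarrow> bool" where
  "is_mp_inverse A X \<longleftrightarrow>
     A ** X ** A = A \<and> X ** A ** X = X \<and>
     transpose (A ** X) = A ** X \<and> transpose (X ** A) = X ** A"

definition mp_inverse :: "real^'n^'m \<Rightarrow> real^'m^'n" where
  "mp_inverse A = (THE X. is_mp_inverse A X)"

text \<open>All complex eigenvalues of a real matrix are taken into account.\<close>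

definition complex_eigenvalues :: "real^'n^'n \<Rightarrow> complex set" where
  "complex_eigenvalues A = {k. \<exists>v. v \<noteq> 0 \<and> map_matrix complex_of_real A *v v = k *s v}"

definition spec_radius :: "real^'n^'n \<Rightarrow> real" where
  "spec_radius A = Max (cmod ` complex_eigenvalues A)"

definition proper_splitting :: "real^'n^'m \<Rightarrow> real^'n^'m \<Rightarrow> real^'n^'m \<Rightarrow> bool" where
  "proper_splitting A M N \<longleftrightarrow>
     A = M - N \<and>
     range (\<lambda>x. A *v x) = range (\<lambda>x. M *v x) \<and>
     {x. A *v x = 0} = {x. M *v x = 0}"

definition weak_proper_splitting_2 :: "real^'n^'m \<Rightarrow> real^'n^'m \<Rightarrow> real^'n^'m \<Rightarrow> bool" where
  "weak_proper_splitting_2 A M N \<longleftrightarrow>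
     proper_splitting A M N \<and> 0 \<le> N ** mp_inverse M"

definition weak_splitting_2 :: "real^'n^'n \<Rightarrow> real^'n^'n \<Rightarrow> real^'n^'n \<Rightarrow> bool" where
  "weak_splitting_2 B U V \<longleftrightarrow>
     invertible B \<and> B = U - V \<and> invertible U \<and> 0 \<le> V ** matrix_inv U"

definition shifted_gram :: "real^'n^'n \<Rightarrow> real \<Rightarrow> real^'n^'n" where
  "shifted_gram A l = transpose A ** A + l *\<^sub>R mat 1"

end

theory Submission
  imports Defs "HOL-Computational_Algebra.Fundamental_Theorem_Algebra"
begin

text \<open>
  Put \<open>T = N M\<^sup>\<dagger>\<close> and \<open>G = N A\<^sup>\<dagger>\<close>, and likewise \<open>T\<^sub>\<lambda> = N\<^sub>\<lambda> M\<^sub>\<lambda>\<inverse>\<close> and \<open>G\<^sub>\<lambda> = N\<^sub>\<lambda> B\<^sub>\<lambda>\<inverse>\<close>. In both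
  cases \<open>(1 - T) (1 + G) = 1\<close>, and the iteration matrices \<open>M\<^sup>\<dagger> N\<close>, \<open>M\<^sub>\<lambda>\<inverse> N\<^sub>\<lambda>\<close> have the spectral radii of
  \<open>T\<close>, \<open>T\<^sub>\<lambda>\<close>. Nonnegativity of \<open>T\<^sub>\<lambda>\<close> keeps it bounded as \<open>G\<^sub>\<lambda>\<close> approaches \<open>L \<ge> 0\<close>, so that
  \<open>T\<^sub>\<lambda>\<close> converges to \<open>T\<^sub>0 = 1 - (1 + L)\<inverse>\<close>, and the spectral radii converge by continuity. For nonnegative
  \<open>T\<close> and \<open>G\<close>, Perron-Frobenius theory gives \<open>\<rho>(T) = \<rho>(G) / (1 + \<rho>(G)) < 1\<close>, which is monotone in \<open>G\<close>.
\<close>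

section \<open>Auxiliary matrix identities and limits\<close>

lemma matrix_diff_ldistrib:
  fixes A :: "'a::ring_1^'m^'n"
  shows "A ** (B - C) = A ** B - A ** C"
  by (simp add: matrix_matrix_mult_def vec_eq_iff right_diff_distrib sum_subtractf)

lemma matrix_diff_rdistrib:
  fixes A B :: "'a::ring_1^'m^'n"
  shows "(A - B) ** C = A ** C - B ** C"
  by (simp add: matrix_matrix_mult_def vec_eq_iff left_diff_distrib sum_subtractf)

lemma matrix_add_rdistrib:
  fixes A B :: "'a::semiring_1^'m^'n"
  shows "(A + B) ** C = A ** C + B ** C"
  by (simp add: matrix_matrix_mult_def vec_eq_iff distrib_right sum.distrib)

lemma matrix_inv_mult:
  fixes A :: "'a::semiring_1^'n^'m"
  assumes "invertible A"
  shows "A ** matrix_inv A = mat 1" and "matrix_inv A ** A = mat 1"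
  using someI_ex[OF assms[unfolded invertible_def]] by (simp_all add: matrix_inv_def)

lemma tendsto_matrix_matrix_mult:
  fixes f :: "'b \<Rightarrow> real^'m^'n"
  assumes "(f \<longlongrightarrow> A) F" and "(g \<longlongrightarrow> B) F"
  shows "((\<lambda>x. f x ** g x) \<longlongrightarrow> A ** B) F"
  unfolding matrix_matrix_mult_def by (intro tendsto_intros assms)

subsection \<open>The spectral radius of a real matrix\<close>

text \<open>Serves both the characteristic polynomial and its reversal: each is the determinant of a
  matrix of linear polynomials.\<close>

lemma poly_det_pencil:
  fixes A B :: "'a::comm_ring_1^'n^'n"
  shows "poly (det (\<chi> i j. [:A $ i $ j, B $ i $ j:])) w = det (\<chi> i j. A $ i $ j + w * B $ i $ j)"
  by (simp add: det_def poly_sum poly_prod)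

lemma degree_det_pencil_le:
  fixes A B :: "'a::comm_ring_1^'n^'n"
  shows "degree (det (\<chi> i j. [:A $ i $ j, B $ i $ j:])) \<le> CARD('n)"
  unfolding det_def
proof (rule degree_sum_le)
  fix p :: "'n \<Rightarrow> 'n"
  let ?q = "\<lambda>i. [:A $ i $ p i, B $ i $ p i:]"
  have "degree (of_int (sign p) * prod ?q UNIV) \<le> degree (prod ?q UNIV)"
    by (rule order_trans[OF degree_mult_le]) simp
  also have "\<dots> \<le> sum (degree \<circ> ?q) UNIV"
    by (rule degree_prod_sum_le) simp
  also have "\<dots> \<le> sum (\<lambda>_. 1) (UNIV :: 'n set)"
    by (rule sum_mono) simp
  finally show "degree (of_int (sign p) * (\<Prod>i\<in>UNIV. (\<chi> i j. [:A $ i $ j, B $ i $ j:]) $ i $ p i))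
      \<le> CARD('n)"
    by simp
qed simp

lemma det_eq_0_iff_kernel:
  fixes A :: "'a::field^'n^'n"
  shows "det A = 0 \<longleftrightarrow> (\<exists>v. v \<noteq> 0 \<and> A *v v = 0)"
  using invertible_det_nz[of A] invertible_left_inverse[of A] matrix_left_invertible_ker[of A]
  by auto

text \<open>The reversed characteristic polynomial \<open>w \<mapsto> det (1 - w X)\<close>: its roots are the inverses of
  the nonzero eigenvalues, and it is normalised at \<open>0\<close>, so no leading coefficient is needed.\<close>

definition rev_charpoly :: "real^'n^'n \<Rightarrow> complex poly" where
  "rev_charpoly X = det (\<chi> i j. [:if i = j then 1 else 0, - complex_of_real (X $ i $ j):])"

lemma poly_rev_charpoly:
  "poly (rev_charpoly X) w = det (\<chi> i j. (if i = j then 1 else 0) - w * complex_of_real (X $ i $ j))"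
  using poly_det_pencil[of "\<chi> i j. if i = j then 1 else 0" "\<chi> i j. - complex_of_real (X $ i $ j)" w]
  by (simp add: rev_charpoly_def)

lemma poly_rev_charpoly_0 [simp]: "poly (rev_charpoly (X :: real^'n^'n)) 0 = 1"
proof -
  have "det ((\<chi> i j. if i = j then 1 else 0) :: complex^'n^'n) = 1"
    by (metis det_I mat_def)
  then show ?thesis
    by (simp add: poly_rev_charpoly)
qed

lemma rev_charpoly_nz [simp]: "rev_charpoly X \<noteq> 0"
  using poly_rev_charpoly_0[of X] by force

lemma degree_rev_charpoly_le: "degree (rev_charpoly (X :: real^'n^'n)) \<le> CARD('n)"
  using degree_det_pencil_le[of "\<chi> i j. if i = j then 1 else 0" "\<chi> i j. - complex_of_real (X $ i $ j)"]
  by (simp add: rev_charpoly_def)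

lemma complex_eigenvalues_iff_det:
  "k \<in> complex_eigenvalues X \<longleftrightarrow>
     det (\<chi> i j. (if i = j then k else 0) - complex_of_real (X $ i $ j)) = 0"
proof -
  let ?P = "\<chi> i j. (if i = j then k else 0) - complex_of_real (X $ i $ j)"
  have "?P *v v = k *s v - map_matrix complex_of_real X *v v" for v
    by (simp add: matrix_vector_mult_def vec_eq_iff left_diff_distrib sum_subtractf
        if_distrib[where f="\<lambda>x. x * _"] cong: if_cong)
  then have "map_matrix complex_of_real X *v v = k *s v \<longleftrightarrow> ?P *v v = 0" for v
    by auto
  then show ?thesis
    by (simp add: complex_eigenvalues_def det_eq_0_iff_kernel)
qed

lemma det_scale:
  fixes A :: "'a::comm_ring_1^'n^'n"
  shows "det (\<chi> i j. c * A $ i $ j) = c ^ CARD('n) * det A"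
  using det_rows_mul[of "\<lambda>_. c" "\<lambda>i. A $ i"] by (simp add: vector_scalar_mult_def)

text \<open>Scaling \<open>k - X\<close> by \<open>inverse k\<close> gives
  \<open>1 - inverse k * X\<close>, so the two determinants vanish together.\<close>

lemma complex_eigenvalues_iff_rev_charpoly:
  assumes "k \<noteq> 0"
  shows "k \<in> complex_eigenvalues X \<longleftrightarrow> poly (rev_charpoly X) (inverse k) = 0"
proof -
  let ?P = "\<chi> i j. (if i = j then k else 0) - complex_of_real (X $ i $ j)"
  have "(\<chi> i j. (if i = j then 1 else 0) - inverse k * complex_of_real (X $ i $ j))
      = (\<chi> i j. inverse k * ?P $ i $ j)"
    using assms by (simp add: vec_eq_iff right_diff_distrib)
  then have "poly (rev_charpoly X) (inverse k) = inverse k ^ CARD('a) * det ?P"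
    using det_scale[of "inverse k" ?P] by (simp only: poly_rev_charpoly)
  then show ?thesis
    using assms by (simp add: complex_eigenvalues_iff_det)
qed

text \<open>Together with nonemptiness this makes the \<open>Max\<close> in
  \<open>spec_radius\<close> meaningful. Nonzero eigenvalues are inverses of roots of a nonzero
  polynomial.\<close>

lemma finite_complex_eigenvalues: "finite (complex_eigenvalues X)"
proof (rule finite_subset)
  show "complex_eigenvalues X \<subseteq> insert 0 (inverse ` {w. poly (rev_charpoly X) w = 0})"
  proof
    fix k assume k: "k \<in> complex_eigenvalues X"
    show "k \<in> insert 0 (inverse ` {w. poly (rev_charpoly X) w = 0})"
    proof (cases "k = 0")
      case False
      then have "inverse k \<in> {w. poly (rev_charpoly X) w = 0}"
        using k complex_eigenvalues_iff_rev_charpoly by blast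
      then show ?thesis
        by (metis image_eqI inverse_inverse_eq insertCI)
    qed simp
  qed
  show "finite (insert 0 (inverse ` {w. poly (rev_charpoly X) w = 0}))"
    by (simp add: poly_roots_finite)
qed

text \<open>Without eigenvalues the characteristic polynomial is a constant \<open>c\<close>, so that the reversed one
  is \<open>c w\<^sup>n\<close>; but that one has the value 1 at \<open>w = 0\<close>.\<close>

lemma complex_eigenvalues_nonempty: "complex_eigenvalues (X :: real^'n^'n) \<noteq> {}"
proof
  assume empty: "complex_eigenvalues X = {}"
  define p where "p = det (\<chi> i j. [:- complex_of_real (X $ i $ j), if i = j then 1 else 0:])"
  have poly_p: "poly p k = det (\<chi> i j. (if i = j then k else 0) - complex_of_real (X $ i $ j))" for k
  proof -
    have "(\<chi> i j. - complex_of_real (X $ i $ j) + k * (if i = j then 1 else 0))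
        = (\<chi> i j. (if i = j then k else 0) - complex_of_real (X $ i $ j))"
      by (simp add: vec_eq_iff)
    then show ?thesis
      using poly_det_pencil[of "\<chi> i j. - complex_of_real (X $ i $ j)" "\<chi> i j. if i = j then 1 else 0" k]
      by (simp add: p_def)
  qed
  have nz: "poly p k \<noteq> 0" for k
    using empty complex_eigenvalues_iff_det[of k X] poly_p by auto
  then have "constant (poly p)"
    using fundamental_theorem_of_algebra by blast
  then obtain c where c: "\<And>k. poly p k = c"
    unfolding constant_def by metis
  have "poly (rev_charpoly X) w = poly (monom c CARD('n)) w" if "w \<noteq> 0" for w
  proof -
    have "(\<chi> i j. (if i = j then 1 else 0) - w * complex_of_real (X $ i $ j))
        = (\<chi> i j. w * (\<chi> i j. (if i = j then inverse w else 0) - complex_of_real (X $ i $ j)) $ i $ j)"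
      using that by (simp add: vec_eq_iff right_diff_distrib)
    then have "poly (rev_charpoly X) w = w ^ CARD('n) * poly p (inverse w)"
      using det_scale[of w "\<chi> i j. (if i = j then inverse w else 0) - complex_of_real (X $ i $ j)"]
      by (simp only: poly_rev_charpoly poly_p)
    then show ?thesis
      by (simp add: c poly_monom)
  qed
  \<comment> \<open>Agreement off 0 is agreement at infinitely many points, hence everywhere; at 0
    the values are 1 and 0, since \<open>CARD('n)\<close> is positive.\<close>
  then have "{w. poly (rev_charpoly X - monom c CARD('n)) w = 0} \<supseteq> UNIV - {0}"
    by auto
  moreover have "infinite (UNIV - {0 :: complex})"
    by (simp add: infinite_UNIV_char_0)
  ultimately have "rev_charpoly X - monom c CARD('n) = 0"
    using poly_roots_finite finite_subset by metis
  then have "poly (rev_charpoly X) 0 = poly (monom c CARD('n)) 0"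
    by simp
  then show False
    by (simp add: poly_monom zero_power)
qed

lemma cmod_le_spec_radius: "k \<in> complex_eigenvalues X \<Longrightarrow> cmod k \<le> spec_radius X"
  by (simp add: spec_radius_def finite_complex_eigenvalues)

lemma spec_radius_attained:
  obtains k where "k \<in> complex_eigenvalues X" "spec_radius X = cmod k"
proof -
  have "spec_radius X \<in> cmod ` complex_eigenvalues X"
    unfolding spec_radius_def
    by (rule Max_in) (simp_all add: finite_complex_eigenvalues complex_eigenvalues_nonempty)
  then show ?thesis
    using that by blast
qed

lemma spec_radius_nonneg [simp]: "0 \<le> spec_radius X"
  by (metis norm_ge_zero spec_radius_attained)

text \<open>Every root \<open>a\<close> is the inverse of an eigenvalue, so each normalised factor
  \<open>1 - w / a\<close> has modulus at least \<open>1 - cmod w * spec_radius X\<close>. The bound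
  depends on \<open>X\<close> only through its spectral radius, so it can be applied uniformly to
  nearby matrices.\<close>

lemma rev_charpoly_lower_bound:
  fixes X :: "real^'n^'n"
  assumes "cmod w * spec_radius X \<le> 1"
  shows "(1 - cmod w * spec_radius X) ^ CARD('n) \<le> cmod (poly (rev_charpoly X) w)"
proof -
  let ?r = "1 - cmod w * spec_radius X"
  obtain R where R: "size R = degree (rev_charpoly X)"
      "rev_charpoly X = smult (lead_coeff (rev_charpoly X)) (\<Prod>a\<in>#R. [:- a, 1:])"
    using alg_closed_imp_factorization[OF rev_charpoly_nz] by blast
  define l where "l = lead_coeff (rev_charpoly X)"
  have eval: "poly (rev_charpoly X) z = l * (\<Prod>a\<in>#R. z - a)" for z
    by (subst R(2)) (simp add: l_def poly_prod_mset image_mset.compositionality o_def)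
  have roots: "a \<noteq> 0 \<and> cmod (inverse a) \<le> spec_radius X" if "a \<in># R" for a
  proof -
    have "(\<Prod>a'\<in>#R. a - a') = 0"
      using that by (auto simp: prod_mset_zero_iff)
    then have "poly (rev_charpoly X) a = 0"
      by (simp add: eval)
    moreover from this have "a \<noteq> 0"
      using poly_rev_charpoly_0[of X] by force
    ultimately show ?thesis
      using complex_eigenvalues_iff_rev_charpoly[of "inverse a" X] cmod_le_spec_radius by auto
  qed
  \<comment> \<open>The factors \<open>0 - a\<close> do the normalising: for \<open>Q = R\<close>
    their product times \<open>l\<close> is the value at 0, which is 1.\<close>
  have prod_bound: "?r ^ size Q * cmod (\<Prod>a\<in>#Q. 0 - a) \<le> cmod (\<Prod>a\<in>#Q. w - a)"
    if "set_mset Q \<subseteq> set_mset R" for Q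
    using that
  proof (induction Q)
    case (add a Q)
    then have a: "a \<noteq> 0" "cmod (inverse a) \<le> spec_radius X"
      using roots by auto
    have "1 \<le> spec_radius X * cmod a"
      using a mult_right_mono[OF a(2), of "cmod a"] by (simp add: norm_inverse)
    then have "cmod w \<le> cmod w * spec_radius X * cmod a"
      using mult_left_mono[of 1 "spec_radius X * cmod a" "cmod w"] by (simp add: mult_ac)
    then have "?r * cmod a \<le> cmod a - cmod w"
      by (simp add: algebra_simps)
    also have "\<dots> \<le> cmod (w - a)"
      by (metis norm_minus_commute norm_triangle_ineq2)
    finally have "(?r * cmod a) * (?r ^ size Q * cmod (\<Prod>a\<in>#Q. 0 - a))
        \<le> cmod (w - a) * cmod (\<Prod>a\<in>#Q. w - a)"
      using add assms by (intro mult_mono) auto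
    then show ?case
      by (simp add: norm_mult mult_ac)
  qed simp
  \<comment> \<open>The degree drops below \<open>CARD('n)\<close> if 0 is an eigenvalue; as
    \<open>?r\<close> lies in [0, 1], the larger exponent gives the smaller power.\<close>
  have "?r ^ CARD('n) \<le> ?r ^ size R"
    using R(1) degree_rev_charpoly_le[of X] assms by (intro power_decreasing) auto
  also have "\<dots> = cmod l * (?r ^ size R * cmod (\<Prod>a\<in>#R. 0 - a))"
  proof -
    have "cmod l * cmod (\<Prod>a\<in>#R. 0 - a) = 1"
      by (metis eval norm_mult norm_one poly_rev_charpoly_0)
    then show ?thesis
      by (simp add: mult.left_commute)
  qed
  also have "\<dots> \<le> cmod l * cmod (\<Prod>a\<in>#R. w - a)"
    by (intro mult_left_mono prod_bound) auto
  finally show ?thesis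
    by (simp add: eval norm_mult)
qed

text \<open>For \<open>k \<noteq> 0\<close>, \<open>Y\<close> maps eigenvectors of
  \<open>X ** Y\<close> to eigenvectors of \<open>Y ** X\<close>. This exchanges the iteration
  matrices for the products with the nonnegativity hypothesis.\<close>

lemma spec_radius_mult_commute:
  fixes X Y :: "real^'n^'n"
  shows "spec_radius (X ** Y) = spec_radius (Y ** X)"
proof -
  have map_mult: "map_matrix complex_of_real (X ** Y)
      = map_matrix complex_of_real X ** map_matrix complex_of_real Y" for X Y :: "real^'n^'n"
    by (simp add: matrix_matrix_mult_def vec_eq_iff)
  have le: "spec_radius (X ** Y) \<le> spec_radius (Y ** X)" for X Y :: "real^'n^'n"
  proof -
    obtain k where k: "k \<in> complex_eigenvalues (X ** Y)" "spec_radius (X ** Y) = cmod k"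
      by (rule spec_radius_attained)
    show ?thesis
    proof (cases "k = 0")
      case False
      let ?X = "map_matrix complex_of_real X" and ?Y = "map_matrix complex_of_real Y"
      obtain v where v: "v \<noteq> 0" "?X *v (?Y *v v) = k *s v"
        using k(1) by (auto simp: complex_eigenvalues_def map_mult simp flip: matrix_vector_mul_assoc)
      have "?Y *v v \<noteq> 0"
        using v False by auto
      moreover have "?Y *v (?X *v (?Y *v v)) = k *s (?Y *v v)"
        by (simp add: v vec.scale)
      ultimately have "k \<in> complex_eigenvalues (Y ** X)"
        by (auto simp: complex_eigenvalues_def map_mult simp flip: matrix_vector_mul_assoc)
      then show ?thesis
        using k(2) cmod_le_spec_radius by metis
    qed (simp add: k)
  qed
  show ?thesis
    by (intro antisym le)
qed

section \<open>Continuity of the spectral radius\<close>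

lemma continuous_on_rev_charpoly:
  "continuous_on UNIV (\<lambda>(X :: real^'n^'n, w). poly (rev_charpoly X) w)"
  unfolding poly_rev_charpoly det_def case_prod_unfold
  by (intro continuous_intros)

text \<open>Lower semicontinuity: at the inverse of a dominant eigenvalue of \<open>X\<close> the
  reversed polynomial of a nearby \<open>Y\<close> is small, which the lower bound excludes if
  \<open>spec_radius Y\<close> is too small. Upper semicontinuity: a closed disc without roots for
  \<open>X\<close> stays without roots nearby.\<close>

lemma isCont_spec_radius: "isCont spec_radius (X :: real^'n^'n)"
  unfolding continuous_at
proof (rule order_tendstoI)
  fix a assume a: "a < spec_radius X"
  show "\<forall>\<^sub>F Y in at X. a < spec_radius Y"
  proof (cases "a < 0")
    case False
    obtain k where k: "k \<in> complex_eigenvalues X" "spec_radius X = cmod k"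
      by (rule spec_radius_attained)
    \<comment> \<open>Chosen so that \<open>spec_radius Y \<le> a\<close> would force a polynomial
      value of modulus at least \<open>b ^ CARD('n)\<close> at \<open>inverse k\<close>.\<close>
    define b where "b = 1 - a / cmod k"
    have "k \<noteq> 0" and b: "0 < b"
      using False a k by (auto simp: b_def divide_less_eq)
    have "isCont (\<lambda>Y. poly (rev_charpoly Y) (inverse k)) X"
    proof -
      have "continuous_on UNIV (\<lambda>Y :: real^'n^'n. poly (rev_charpoly Y) (inverse k))"
        using continuous_on_compose2[OF continuous_on_rev_charpoly, of UNIV "\<lambda>Y. (Y, inverse k)"]
        by (simp add: continuous_on_Pair)
      then show ?thesis
        by (simp add: continuous_on_eq_continuous_at)
    qed
    then have "((\<lambda>Y. cmod (poly (rev_charpoly Y) (inverse k))) \<longlongrightarrow> 0) (at X)"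
      using k(1) \<open>k \<noteq> 0\<close> complex_eigenvalues_iff_rev_charpoly[of k X] tendsto_norm_zero
      by (simp add: isCont_def)
    then have "\<forall>\<^sub>F Y in at X. cmod (poly (rev_charpoly Y) (inverse k)) < b ^ CARD('n)"
      using b by (intro order_tendstoD) auto
    then show ?thesis
    proof eventually_elim
      case (elim Y)
      show ?case
      proof (rule ccontr)
        assume "\<not> a < spec_radius Y"
        then have "cmod (inverse k) * spec_radius Y \<le> 1 - b"
          using \<open>k \<noteq> 0\<close> by (simp add: b_def norm_inverse divide_inverse mult.commute mult_right_mono)
        then have "b ^ CARD('n) \<le> (1 - cmod (inverse k) * spec_radius Y) ^ CARD('n)"
          using b by (intro power_mono) auto
        also have "\<dots> \<le> cmod (poly (rev_charpoly Y) (inverse k))"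
          using \<open>_ \<le> 1 - b\<close> b by (intro rev_charpoly_lower_bound) simp
        finally show False
          using elim by simp
      qed
    qed
  qed (auto intro!: always_eventually intro: less_le_trans[OF _ spec_radius_nonneg])
next
  fix a assume a: "spec_radius X < a"
  then have "0 < a"
    using spec_radius_nonneg[of X] by linarith
  \<comment> \<open>The tube lemma, using compactness of the disc, turns root-freeness for
    \<open>X\<close> into root-freeness for a whole neighbourhood \<open>U\<close>.\<close>
  define W where "W = {(Y :: real^'n^'n, w). poly (rev_charpoly Y) w \<noteq> 0}"
  have "open W"
  proof -
    have "W = (\<lambda>(Y, w). poly (rev_charpoly Y) w) -` (- {0})"
      by (auto simp: W_def)
    then show ?thesis
      using open_vimage[OF _ continuous_on_rev_charpoly, of "- {0}"] by (simp add: open_Compl)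
  qed
  moreover have "{X} \<times> cball 0 (inverse a) \<subseteq> W"
  proof -
    have "poly (rev_charpoly X) w \<noteq> 0" if "cmod w \<le> inverse a" for w
    proof
      assume root: "poly (rev_charpoly X) w = 0"
      then have "w \<noteq> 0"
        by auto
      then have "cmod (inverse w) \<le> spec_radius X"
        using root complex_eigenvalues_iff_rev_charpoly[of "inverse w" X]
        by (intro cmod_le_spec_radius) auto
      moreover have "a \<le> cmod (inverse w)"
        using that \<open>w \<noteq> 0\<close> \<open>0 < a\<close> le_imp_inverse_le[of "cmod w" "inverse a"]
        by (simp add: norm_inverse)
      ultimately show False
        using a by simp
    qed
    then show ?thesis
      by (auto simp: W_def)
  qed
  ultimately have "\<exists>U. X \<in> U \<and> open U \<and> U \<times> cball 0 (inverse a) \<subseteq> W"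
    by (rule Elementary_Topology.tube_lemma[OF compact_cball])
  then obtain U where U: "X \<in> U" "open U" "U \<times> cball 0 (inverse a) \<subseteq> W"
    by blast
  have "spec_radius Y < a" if "Y \<in> U" for Y
  proof (rule ccontr)
    assume "\<not> spec_radius Y < a"
    moreover obtain k where k: "k \<in> complex_eigenvalues Y" "spec_radius Y = cmod k"
      by (rule spec_radius_attained)
    ultimately have "a \<le> cmod k"
      by simp
    then have "k \<noteq> 0" and "inverse k \<in> cball 0 (inverse a)"
      using \<open>0 < a\<close> le_imp_inverse_le[of a "cmod k"] by (auto simp: norm_inverse)
    then have "(Y, inverse k) \<in> W"
      using U(3) that by blast
    then show False
      using k(1) complex_eigenvalues_iff_rev_charpoly[OF \<open>k \<noteq> 0\<close>, of Y] by (simp add: W_def)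
  qed
  then show "\<forall>\<^sub>F Y in at X. spec_radius Y < a"
    using U(1,2) by (auto simp: eventually_at_topological)
qed

subsection \<open>Nonnegative matrices\<close>

lemma matrix_vector_mult_mono:
  fixes S :: "real^'n^'m"
  assumes "0 \<le> S" and "x \<le> y"
  shows "S *v x \<le> S *v y"
  using assms by (auto simp: less_eq_vec_def matrix_vector_mult_def intro!: sum_mono mult_left_mono)

lemma matrix_vector_mult_mono_left:
  fixes S :: "real^'n^'m"
  assumes "S \<le> R" and "0 \<le> x"
  shows "S *v x \<le> R *v x"
  using assms by (auto simp: less_eq_vec_def matrix_vector_mult_def intro!: sum_mono mult_right_mono)

text \<open>Brouwer's theorem for \<open>x \<mapsto> S x / \<Sum>\<^sub>i (S x)\<^sub>i\<close> on the part of the standard simplex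
  where \<open>c x \<le> S x\<close>, which is convex and invariant.\<close>

lemma nonneg_eigenvector_exists:
  fixes S :: "real^'n^'n"
  assumes S: "0 \<le> S" and u: "0 \<le> u" "u \<noteq> 0" and c: "0 < c" and sub: "c *\<^sub>R u \<le> S *v u"
  obtains t x where "c \<le> t" "0 \<le> x" "x \<noteq> 0" "S *v x = t *\<^sub>R x"
proof -
  define s where "s x = (\<Sum>i\<in>UNIV. x $ i)" for x :: "real^'n"
  \<comment> \<open>The box supplies nonnegativity and compactness; its upper bound 1 is automatic
    for nonnegative vectors with coordinate sum 1.\<close>
  define D where "D = {0..1} \<inter> {x. s x = 1} \<inter> {x. \<forall>i. c * x $ i \<le> (S *v x) $ i}"
  have lin: "linear s"
    by (auto intro!: linearI simp: s_def sum.distrib sum_distrib_left)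
  have D_I: "x \<in> D" if "0 \<le> x" "s x = 1" "c *\<^sub>R x \<le> S *v x" for x
  proof -
    have "x $ i \<le> 1" for i
      using that member_le_sum[of i UNIV "\<lambda>i. x $ i"] by (simp add: s_def less_eq_vec_def)
    then show ?thesis
      using that by (simp add: D_def less_eq_vec_def)
  qed
  have s_pos: "0 < s x" if "0 \<le> x" "x \<noteq> 0" for x
  proof -
    obtain i where "x $ i \<noteq> 0"
      using \<open>x \<noteq> 0\<close> unfolding vec_eq_iff by auto
    then show ?thesis
      using that unfolding s_def by (intro sum_pos2[of _ i]) (auto simp: less_eq_vec_def less_le)
  qed
  have normalize: "(1 / s x) *\<^sub>R x \<in> D" if x: "0 \<le> x" "x \<noteq> 0" "c *\<^sub>R x \<le> S *v x" for x
  proof (rule D_I)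
    show "0 \<le> (1 / s x) *\<^sub>R x"
      using x s_pos[of x] by (simp add: less_eq_vec_def)
    show "s ((1 / s x) *\<^sub>R x) = 1"
      using s_pos[of x] x by (simp add: linear_scale[OF lin])
    have "(1 / s x) *\<^sub>R (c *\<^sub>R x) \<le> (1 / s x) *\<^sub>R (S *v x)"
      using s_pos[of x] x by (intro scaleR_left_mono) auto
    then show "c *\<^sub>R ((1 / s x) *\<^sub>R x) \<le> S *v ((1 / s x) *\<^sub>R x)"
      by (simp add: matrix_vector_mult_scaleR mult.commute)
  qed
  have in_D: "0 \<le> x" "x \<noteq> 0" "c *\<^sub>R x \<le> S *v x" if "x \<in> D" for x
  proof -
    show "0 \<le> x" "c *\<^sub>R x \<le> S *v x"
      using that by (auto simp: D_def less_eq_vec_def)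
    show "x \<noteq> 0"
      using that by (auto simp: D_def s_def)
  qed
  have image: "0 \<le> S *v x" "S *v x \<noteq> 0" "c *\<^sub>R (S *v x) \<le> S *v (S *v x)" if "x \<in> D" for x
  proof -
    show "0 \<le> S *v x"
      using matrix_vector_mult_mono[OF S in_D(1)[OF that]] by simp
    show "c *\<^sub>R (S *v x) \<le> S *v (S *v x)"
      using matrix_vector_mult_mono[OF S in_D(3)[OF that]] by (simp add: matrix_vector_mult_scaleR)
    \<comment> \<open>Here \<open>c > 0\<close> matters:
      \<open>c *\<^sub>R x \<le> S *v x = 0\<close> would force \<open>x = 0\<close>. Hence the
      normalisation in \<open>f\<close> never divides by 0.\<close>
    show "S *v x \<noteq> 0"
    proof
      assume "S *v x = 0"
      then have "x \<le> 0"
        using in_D(3)[OF that] c by (simp add: less_eq_vec_def mult_le_0_iff)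
      then show False
        using in_D(1,2)[OF that] by (simp add: antisym)
    qed
  qed
  define f where "f x = (1 / s (S *v x)) *\<^sub>R (S *v x)" for x
  have "continuous_on D s" "continuous_on D (\<lambda>x. S *v x)" for D
    using lin by (auto intro: linear_continuous_on simp: linear_conv_bounded_linear)
  have cont: "continuous_on D f"
  proof -
    have "continuous_on D (\<lambda>x. s (S *v x))"
      by (rule continuous_on_compose2[of UNIV s]) (fact | simp)+
    moreover have "s (S *v x) \<noteq> 0" if "x \<in> D" for x
      using s_pos[OF image(1,2)[OF that]] by simp
    ultimately show ?thesis
      unfolding f_def using \<open>continuous_on D (\<lambda>x. S *v x)\<close> by (intro continuous_intros) auto
  qed
  have "closed {x. s x = 1}"
    using \<open>\<And>D. continuous_on D s\<close> by (intro closed_Collect_eq continuous_intros)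
  moreover have "closed {x. \<forall>i. c * x $ i \<le> (S *v x) $ i}"
    using \<open>\<And>D. continuous_on D (\<lambda>x. S *v x)\<close>
    by (intro closed_Collect_all closed_Collect_le continuous_intros)
  ultimately have "compact D"
    unfolding D_def by (intro compact_Int_closed compact_interval)
  moreover have "convex D"
  proof -
    have "convex {x. s x = 1}"
      by (auto simp: convex_def linear_add[OF lin] linear_scale[OF lin])
    moreover have "convex {x. \<forall>i. c * x $ i \<le> (S *v x) $ i}"
    proof (rule convexI, clarsimp)
      fix x y :: "real^'n" and a b :: real and i
      assume "\<forall>i. c * x $ i \<le> (S *v x) $ i" "\<forall>i. c * y $ i \<le> (S *v y) $ i" "0 \<le> a" "0 \<le> b"
      then have "a * (c * x $ i) + b * (c * y $ i) \<le> a * (S *v x) $ i + b * (S *v y) $ i"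
        by (intro add_mono mult_left_mono) auto
      then show "c * (a * x $ i + b * y $ i) \<le> (S *v (a *\<^sub>R x + b *\<^sub>R y)) $ i"
        by (simp add: matrix_vector_right_distrib matrix_vector_mult_scaleR algebra_simps)
    qed
    ultimately show ?thesis
      unfolding D_def by (intro convex_Int) auto
  qed
  moreover have "D \<noteq> {}"
    using normalize u sub by blast
  moreover have "f \<in> D \<rightarrow> D"
    using normalize image by (auto simp: f_def)
  ultimately obtain x where x: "x \<in> D" "f x = x"
    using brouwer[of D f] cont by blast
  define t where "t = s (S *v x)"
  have eig: "S *v x = t *\<^sub>R x"
  proof -
    have "S *v x = t *\<^sub>R f x"
      using s_pos image x(1) by (force simp: f_def t_def)
    then show ?thesis
      by (simp add: x)
  qed
  \<comment> \<open>Summing the coordinates compares \<open>c\<close> with \<open>t\<close>, because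
    \<open>s x\<close> is positive.\<close>
  have "s (c *\<^sub>R x) \<le> s (t *\<^sub>R x)"
    using in_D(3)[OF x(1)] unfolding s_def eig[symmetric] by (intro sum_mono) (simp add: less_eq_vec_def)
  then have "c \<le> t"
    using s_pos[OF in_D(1,2)[OF x(1)]] by (simp add: linear_scale[OF lin])
  then show ?thesis
    using that in_D[OF x(1)] eig by blast
qed

lemma complex_of_real_eigenvalue:
  assumes "x \<noteq> 0" and "T *v x = t *\<^sub>R x"
  shows "complex_of_real t \<in> complex_eigenvalues T"
proof -
  let ?v = "\<chi> i. complex_of_real (x $ i)"
  have "?v \<noteq> 0"
    using assms(1) by (auto simp: vec_eq_iff)
  moreover have "map_matrix complex_of_real T *v ?v = complex_of_real t *s ?v"
  proof -
    have "(map_matrix complex_of_real T *v ?v) $ i = complex_of_real ((T *v x) $ i)" for i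
      by (simp add: matrix_vector_mult_def)
    then show ?thesis
      by (simp add: vec_eq_iff assms(2))
  qed
  ultimately show ?thesis
    unfolding complex_eigenvalues_def by blast
qed

text \<open>Take entrywise moduli of a complex eigenvector for a dominant eigenvalue; the triangle
  inequality and \<open>0 \<le> T\<close> give the estimate.\<close>

lemma spec_radius_subeigenvector:
  fixes T :: "real^'n^'n"
  assumes T: "0 \<le> T"
  obtains u where "0 \<le> u" "u \<noteq> 0" "spec_radius T *\<^sub>R u \<le> T *v u"
proof -
  obtain k where k: "k \<in> complex_eigenvalues T" "spec_radius T = cmod k"
    by (rule spec_radius_attained)
  then obtain v where v: "v \<noteq> 0" "map_matrix complex_of_real T *v v = k *s v"
    by (auto simp: complex_eigenvalues_def)
  define u where "u = (\<chi> i. cmod (v $ i))"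
  have "cmod k * u $ i \<le> (T *v u) $ i" for i
  proof -
    have "cmod k * u $ i = cmod ((k *s v) $ i)"
      by (simp add: u_def norm_mult)
    also have "\<dots> = cmod (\<Sum>j\<in>UNIV. complex_of_real (T $ i $ j) * v $ j)"
      by (subst v(2)[symmetric]) (simp add: matrix_vector_mult_def)
    also have "\<dots> \<le> (\<Sum>j\<in>UNIV. cmod (complex_of_real (T $ i $ j) * v $ j))"
      by (rule norm_sum)
    also have "\<dots> = (T *v u) $ i"
      using T by (simp add: matrix_vector_mult_def u_def norm_mult less_eq_vec_def)
    finally show ?thesis .
  qed
  then have "spec_radius T *\<^sub>R u \<le> T *v u"
    by (simp add: less_eq_vec_def k)
  moreover have "0 \<le> u" "u \<noteq> 0"
    using v(1) by (auto simp: u_def less_eq_vec_def vec_eq_iff)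
  ultimately show ?thesis
    using that by blast
qed

section \<open>Spectral radii under the identity \<open>(1 - T) (1 + G) = 1\<close>\<close>

lemma one_minus_one_plus_commute:
  fixes T G :: "real^'n^'n"
  assumes "(mat 1 - T) ** (mat 1 + G) = mat 1"
  shows "(mat 1 + G) *v (x - T *v x) = x"
proof -
  have "(mat 1 + G) ** (mat 1 - T) = mat 1"
    using assms matrix_left_right_inverse by blast
  moreover have "x - T *v x = (mat 1 - T) *v x"
    by (simp add: matrix_vector_mult_diff_rdistrib)
  ultimately show ?thesis
    by (simp add: matrix_vector_mul_assoc)
qed

lemma mat_1_plus_nonneg:
  fixes G :: "real^'n^'n"
  shows "0 \<le> G \<Longrightarrow> 0 \<le> mat 1 + G"
  by (simp add: less_eq_vec_def mat_def)

text \<open>Otherwise a nonnegative subeigenvector has \<open>u \<le> T *v u\<close>; applying the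
  nonnegative matrix \<open>mat 1 + G\<close> to \<open>u - T *v u \<le> 0\<close> returns
  \<open>u \<le> 0\<close>.\<close>

lemma spec_radius_less_one:
  fixes T G :: "real^'n^'n"
  assumes "0 \<le> T" and "0 \<le> G" and inv: "(mat 1 - T) ** (mat 1 + G) = mat 1"
  shows "spec_radius T < 1"
proof (rule ccontr)
  assume "\<not> spec_radius T < 1"
  obtain u where u: "0 \<le> u" "u \<noteq> 0" "spec_radius T *\<^sub>R u \<le> T *v u"
    using spec_radius_subeigenvector[OF \<open>0 \<le> T\<close>] by blast
  have "1 *\<^sub>R u \<le> spec_radius T *\<^sub>R u"
    using \<open>\<not> spec_radius T < 1\<close> u(1) by (intro scaleR_right_mono) auto
  then have "u - T *v u \<le> 0"
    using u(3) by simp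
  then have "(mat 1 + G) *v (u - T *v u) \<le> (mat 1 + G) *v 0"
    using \<open>0 \<le> G\<close> by (intro matrix_vector_mult_mono mat_1_plus_nonneg)
  then have "u \<le> 0"
    using one_minus_one_plus_commute[OF inv] by simp
  then show False
    using u by (simp add: antisym)
qed

text \<open>With \<open>r = \<rho>(T\<^sub>0)\<close>, a subeigenvector \<open>u\<close> of \<open>T\<^sub>0\<close> satisfies \<open>u / (1 - r) \<le> (1 + L) u \<le> (1 + G) u\<close>,
  and the eigenvalue of \<open>1 + G\<close> this produces is turned into one of \<open>T = 1 - (1 + G)\<inverse>\<close>.\<close>

lemma spec_radius_mono_resolvent:
  fixes T T\<^sub>0 G L :: "real^'n^'n"
  assumes "0 \<le> T\<^sub>0" and "0 \<le> L" and "L \<le> G"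
    and inv0: "(mat 1 - T\<^sub>0) ** (mat 1 + L) = mat 1"
    and inv: "(mat 1 - T) ** (mat 1 + G) = mat 1"
  shows "spec_radius T\<^sub>0 \<le> spec_radius T"
proof -
  define r where "r = spec_radius T\<^sub>0"
  have r: "r < 1"
    using spec_radius_less_one assms unfolding r_def by blast
  obtain u where u: "0 \<le> u" "u \<noteq> 0" "r *\<^sub>R u \<le> T\<^sub>0 *v u"
    using spec_radius_subeigenvector[OF \<open>0 \<le> T\<^sub>0\<close>] unfolding r_def by blast
  have "u = (mat 1 + L) *v (u - T\<^sub>0 *v u)"
    using one_minus_one_plus_commute[OF inv0] by simp
  also have "\<dots> \<le> (mat 1 + L) *v ((1 - r) *\<^sub>R u)"
    using u(3) \<open>0 \<le> L\<close>
    by (intro matrix_vector_mult_mono mat_1_plus_nonneg) (auto simp: scaleR_left_diff_distrib)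
  also have "\<dots> \<le> (mat 1 + G) *v ((1 - r) *\<^sub>R u)"
    using \<open>L \<le> G\<close> r u(1)
    by (intro matrix_vector_mult_mono_left add_left_mono scaleR_nonneg_nonneg) auto
  finally have "inverse (1 - r) *\<^sub>R u \<le> inverse (1 - r) *\<^sub>R ((1 - r) *\<^sub>R ((mat 1 + G) *v u))"
    using r by (intro scaleR_left_mono) (auto simp: matrix_vector_mult_scaleR)
  then have "inverse (1 - r) *\<^sub>R u \<le> (mat 1 + G) *v u"
    using r by simp
  moreover have "0 \<le> mat 1 + G" "0 < inverse (1 - r)"
    using assms r by (auto intro: mat_1_plus_nonneg)
  ultimately obtain t x where t: "inverse (1 - r) \<le> t"
    and x: "x \<noteq> 0" "(mat 1 + G) *v x = t *\<^sub>R x"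
    using nonneg_eigenvector_exists u(1,2) by metis
  have "0 < t"
    using t r by (intro less_le_trans[OF _ t]) simp
  have "t *\<^sub>R (x - T *v x) = (mat 1 - T) *v ((mat 1 + G) *v x)"
    by (simp add: x matrix_vector_mult_scaleR matrix_vector_mult_diff_rdistrib scaleR_right_diff_distrib)
  also have "\<dots> = x"
    by (simp add: matrix_vector_mul_assoc inv)
  finally have "inverse t *\<^sub>R (t *\<^sub>R (x - T *v x)) = inverse t *\<^sub>R x"
    by simp
  then have "T *v x = (1 - inverse t) *\<^sub>R x"
    using \<open>0 < t\<close> by (simp add: scaleR_left_diff_distrib algebra_simps)
  then have "cmod (complex_of_real (1 - inverse t)) \<le> spec_radius T"
    using x(1) complex_of_real_eigenvalue cmod_le_spec_radius by blast
  \<comment> \<open>This is \<open>inverse (1 - r) \<le> t\<close> inverted, and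
    \<open>1 - inverse t\<close> is an eigenvalue of \<open>T\<close>.\<close>
  moreover have "r \<le> 1 - inverse t"
    using t r \<open>0 < t\<close> le_imp_inverse_le[OF t] by simp
  ultimately show ?thesis
    unfolding r_def norm_of_real by linarith
qed

text \<open>The column sums \<open>\<sigma>\<close> of \<open>T + G T = G\<close> give \<open>\<Sum>\<^sub>k (1 + \<sigma>\<^sub>k(G)) T\<^sub>k\<^sub>j = \<sigma>\<^sub>j(G)\<close>, where
  \<open>1 + \<sigma>\<^sub>k(G) \<ge> 1/2\<close> near the nonnegative limit; hence \<open>T \<ge> 0\<close> stays bounded even though \<open>G\<close>
  may have negative entries, and \<open>1 + L\<close> cannot be singular.\<close>

lemma tendsto_one_minus_inverse:
  fixes T G :: "'a \<Rightarrow> real^'n^'n"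
  assumes ne: "F \<noteq> bot" and G: "(G \<longlongrightarrow> L) F" and L: "0 \<le> L"
    and ev: "\<forall>\<^sub>F l in F. 0 \<le> T l \<and> (mat 1 - T l) ** (mat 1 + G l) = mat 1"
  obtains T\<^sub>0 where "(T \<longlongrightarrow> T\<^sub>0) F" "0 \<le> T\<^sub>0" "(mat 1 - T\<^sub>0) ** (mat 1 + L) = mat 1"
proof -
  \<comment> \<open>The column sums of \<open>G l\<close> are eventually below those of
    \<open>L\<close> plus 1; the factor 2 undoes the weight 1/2.\<close>
  define K where "K j = 2 * (1 + (\<Sum>i\<in>UNIV. L $ i $ j))" for j
  have sums: "((\<lambda>l. \<Sum>i\<in>UNIV. G l $ i $ j) \<longlongrightarrow> (\<Sum>i\<in>UNIV. L $ i $ j)) F" for j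
    by (intro tendsto_intros G)
  have L_sum: "0 \<le> (\<Sum>i\<in>UNIV. L $ i $ j)" for j
    using L by (intro sum_nonneg) (simp add: less_eq_vec_def)
  have "\<forall>\<^sub>F l in F. \<forall>j. - (1/2) < (\<Sum>i\<in>UNIV. G l $ i $ j)"
    by (intro eventually_all_finite order_tendstoD(1)[OF sums] less_le_trans[OF _ L_sum]) simp
  moreover have "\<forall>\<^sub>F l in F. \<forall>j. (\<Sum>i\<in>UNIV. G l $ i $ j) < 1 + (\<Sum>i\<in>UNIV. L $ i $ j)"
    by (intro eventually_all_finite order_tendstoD(2)[OF sums]) simp
  ultimately have bound: "\<forall>\<^sub>F l in F. \<forall>i j. \<bar>T l $ i $ j\<bar> \<le> K j"
    using ev
  proof eventually_elim
    case (elim l)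
    have T: "0 \<le> T l $ i $ j" for i j
      using elim(3) by (simp add: less_eq_vec_def)
    have "(mat 1 + G l) ** (mat 1 - T l) = mat 1"
      using elim(3) matrix_left_right_inverse by blast
    \<comment> \<open>Expanding the product in this reversed order puts \<open>G\<close> to the left
      of \<open>T\<close>, where its column sums act as weights.\<close>
    then have eq: "T l + G l ** T l = G l"
      by (simp add: matrix_diff_ldistrib matrix_add_rdistrib algebra_simps)
    show ?case
    proof (intro allI)
      fix i j
      let ?s = "\<Sum>k\<in>UNIV. T l $ k $ j"
      have "?s / 2 = (\<Sum>k\<in>UNIV. T l $ k $ j * (1/2))"
        by (simp add: sum_divide_distrib)
      also have "\<dots> \<le> (\<Sum>k\<in>UNIV. T l $ k $ j * (1 + (\<Sum>i\<in>UNIV. G l $ i $ k)))"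
      proof (intro sum_mono mult_left_mono T)
        show "1/2 \<le> 1 + (\<Sum>i\<in>UNIV. G l $ i $ k)" for k
          using elim(1)[rule_format, of k] by linarith
      qed
      also have "\<dots> = ?s + (\<Sum>i\<in>UNIV. \<Sum>k\<in>UNIV. G l $ i $ k * T l $ k $ j)"
        by (subst sum.swap) (simp add: sum_distrib_left distrib_left sum.distrib mult.commute)
      also have "\<dots> = (\<Sum>i\<in>UNIV. (T l + G l ** T l) $ i $ j)"
        by (simp add: matrix_matrix_mult_def sum.distrib)
      also have "\<dots> \<le> K j / 2"
        using elim(2)[rule_format, of j] by (simp add: eq K_def)
      finally have "?s \<le> K j"
        by simp
      moreover have "T l $ i $ j \<le> ?s"
        using T by (intro member_le_sum) auto
      ultimately show "\<bar>T l $ i $ j\<bar> \<le> K j"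
        using T by (simp add: abs_of_nonneg)
    qed
  qed
  \<comment> \<open>Entrywise a sum of products of a bounded factor and one tending to 0.\<close>
  have null: "((\<lambda>l. (mat 1 - T l) ** (G l - L)) \<longlongrightarrow> 0) F"
  proof (intro vec_tendstoI)
    fix i j
    have entry: "((\<lambda>l. (mat 1 - T l) $ i $ k * (G l - L) $ k $ j) \<longlongrightarrow> 0) F" for k
    proof (rule lim_null_mult_left_bounded)
      show "\<forall>\<^sub>F l in F. norm ((mat 1 - T l) $ i $ k) \<le> 1 + K k"
        using bound
      proof eventually_elim
        case (elim l)
        have "\<bar>(mat 1 - T l) $ i $ k\<bar> \<le> \<bar>(mat 1 :: real^'n^'n) $ i $ k\<bar> + \<bar>T l $ i $ k\<bar>"
          by simp
        also have "\<dots> \<le> 1 + K k"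
          using elim by (intro add_mono) (auto simp: mat_def)
        finally show ?case
          by simp
      qed
      have "((\<lambda>l. G l $ k $ j - L $ k $ j) \<longlongrightarrow> L $ k $ j - L $ k $ j) F"
        by (intro tendsto_intros G)
      then show "((\<lambda>l. (G l - L) $ k $ j) \<longlongrightarrow> 0) F"
        by simp
    qed
    have "((\<lambda>l. \<Sum>k\<in>UNIV. (mat 1 - T l) $ i $ k * (G l - L) $ k $ j) \<longlongrightarrow> 0) F"
      by (intro tendsto_null_sum entry)
    then show "((\<lambda>l. ((mat 1 - T l) ** (G l - L)) $ i $ j) \<longlongrightarrow> (0 :: real^'n^'n) $ i $ j) F"
      by (simp add: matrix_matrix_mult_def)
  qed
  have split: "\<forall>\<^sub>F l in F. (mat 1 - T l) ** (mat 1 + L) = mat 1 - (mat 1 - T l) ** (G l - L)"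
    using ev
  proof eventually_elim
    case (elim l)
    have "mat 1 + L = (mat 1 + G l) - (G l - L)"
      by simp
    then show ?case
      using elim by (simp only: matrix_diff_ldistrib)
  qed
  have "((\<lambda>l. mat 1 - (mat 1 - T l) ** (G l - L)) \<longlongrightarrow> mat 1 - 0) F"
    by (intro tendsto_diff tendsto_const null)
  then have to_one: "((\<lambda>l. (mat 1 - T l) ** (mat 1 + L)) \<longlongrightarrow> mat 1) F"
    using split by (simp add: tendsto_cong)
  \<comment> \<open>On such \<open>x\<close> the products converging to the identity are all 0, so
    \<open>x\<close> is a limit of zeros; uniqueness of limits needs
    \<open>F \<noteq> bot\<close>.\<close>
  have "x = 0" if "(mat 1 + L) *v x = 0" for x
  proof -
    have "((\<lambda>l. ((mat 1 - T l) ** (mat 1 + L)) *v x) \<longlongrightarrow> mat 1 *v x) F"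
      unfolding matrix_vector_mult_def by (intro tendsto_intros to_one)
    then have "((\<lambda>l. 0) \<longlongrightarrow> x) F"
      using that by (simp flip: matrix_vector_mul_assoc)
    then show ?thesis
      using ne tendsto_const_iff by metis
  qed
  then obtain R where R: "R ** (mat 1 + L) = mat 1"
    using matrix_left_invertible_ker by blast
  then have R': "(mat 1 + L) ** R = mat 1"
    using matrix_left_right_inverse by blast
  have "((\<lambda>l. (mat 1 - T l) ** (mat 1 + L) ** R) \<longlongrightarrow> mat 1 ** R) F"
    by (intro tendsto_matrix_matrix_mult to_one tendsto_const)
  then have "((\<lambda>l. mat 1 - T l) \<longlongrightarrow> R) F"
    by (simp add: R' flip: matrix_mul_assoc)
  then have "((\<lambda>l. mat 1 - (mat 1 - T l)) \<longlongrightarrow> mat 1 - R) F"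
    by (intro tendsto_diff tendsto_const)
  then have lim: "(T \<longlongrightarrow> mat 1 - R) F"
    by simp
  moreover have "0 \<le> mat 1 - R"
  proof -
    have "0 \<le> (mat 1 - R) $ i $ j" for i j
    proof (rule tendsto_lowerbound)
      show "((\<lambda>l. T l $ i $ j) \<longlongrightarrow> (mat 1 - R) $ i $ j) F"
        by (intro tendsto_intros lim)
      show "\<forall>\<^sub>F l in F. 0 \<le> T l $ i $ j"
        using ev by eventually_elim (simp add: less_eq_vec_def)
    qed (rule ne)
    then show ?thesis
      by (simp add: less_eq_vec_def)
  qed
  ultimately show ?thesis
    using that R by simp
qed

lemma tendsto_spec_radius:
  assumes "(T \<longlongrightarrow> T\<^sub>0) F"
  shows "((\<lambda>l. spec_radius (T l)) \<longlongrightarrow> spec_radius T\<^sub>0) F"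
  using isCont_tendsto_compose[OF isCont_spec_radius assms] .

subsection \<open>The Moore-Penrose inverse\<close>

text \<open>If \<open>transpose A ** A\<close> kills \<open>w\<close>, then \<open>A *v w\<close>
  has inner product 0 with itself.\<close>

lemma gram_cancel:
  fixes A :: "real^'n^'m" and X :: "real^'k^'n"
  assumes "transpose A ** A ** X = transpose A ** A ** Y"
  shows "A ** X = A ** Y"
proof -
  have "A *v (X *v v) = A *v (Y *v v)" for v
  proof -
    let ?w = "X *v v - Y *v v"
    have "transpose A *v (A *v ?w) = 0"
      using assms by (simp add: matrix_vector_mult_diff_distrib matrix_vector_mul_assoc matrix_mul_assoc)
    then have "(A *v ?w) \<bullet> (A *v ?w) = 0"
      by (metis dot_lmul_matrix inner_zero_left transpose_matrix_vector inner_commute inner_zero_right)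
    then show ?thesis
      by (simp add: matrix_vector_mult_diff_distrib)
  qed
  then show ?thesis
    by (simp add: matrix_eq matrix_vector_mul_assoc)
qed

text \<open>The witness is the matrix of a linear map choosing preimages on the range of
  \<open>A\<close>.\<close>

lemma inner_inverse_exists:
  fixes A :: "'a::field^'n^'m"
  obtains X where "A ** X ** A = A"
proof -
  obtain g where g: "Vector_Spaces.linear (*s) (*s) g" "\<And>v. A *v (g (A *v v)) = A *v v"
    using vec.linear_exists_right_inverse_on[OF matrix_vector_mul_linear_gen vec.subspace_UNIV, of A]
    by blast
  have "A ** matrix g ** A = A"
    by (simp add: matrix_eq matrix_works[OF g(1)] g(2) flip: matrix_vector_mul_assoc)
  then show ?thesis
    using that by blast
qed

text \<open>The witness is \<open>H A\<^sup>T\<close> for any inner inverse \<open>H\<close> of \<open>A\<^sup>T A\<close>.\<close>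

lemma least_squares_inverse_exists:
  fixes A :: "real^'n^'m"
  obtains Y where "A ** Y ** A = A" "transpose (A ** Y) = A ** Y"
proof -
  obtain H where H: "transpose A ** A ** H ** (transpose A ** A) = transpose A ** A"
    using inner_inverse_exists by blast
  \<comment> \<open>Stated for every such \<open>H\<close>, since it is applied to the transpose of
    the chosen one as well.\<close>
  have cancel: "A ** H ** transpose A ** A = A"
    if "transpose A ** A ** H ** (transpose A ** A) = transpose A ** A" for H
    using gram_cancel[of A "H ** (transpose A ** A)" "mat 1"] that by (simp add: matrix_mul_assoc)
  let ?P = "A ** (H ** transpose A)"
  have "transpose ?P = A ** transpose H ** transpose A"
    by (simp add: matrix_transpose_mul matrix_mul_assoc)
  moreover have "A ** transpose H ** transpose A ** A = A"
  proof (rule cancel)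
    have "transpose (transpose A ** A ** H ** (transpose A ** A)) = transpose (transpose A ** A)"
      by (simp only: H)
    then show "transpose A ** A ** transpose H ** (transpose A ** A) = transpose A ** A"
      by (simp add: matrix_transpose_mul matrix_mul_assoc)
  qed
  \<comment> \<open>The left-hand side is symmetric by its form, so \<open>?P\<close> is symmetric
    too.\<close>
  ultimately have idem: "transpose ?P ** ?P = ?P"
    by (simp add: matrix_mul_assoc)
  then have "transpose ?P = ?P"
    by (metis matrix_transpose_mul transpose_transpose)
  moreover have "?P ** A = A"
    using cancel[OF H] by (simp add: matrix_mul_assoc)
  ultimately show ?thesis
    using that by blast
qed

text \<open>\<open>A ** X\<close> and \<open>A ** Y\<close> are symmetric projections onto the same
  range, hence equal; likewise \<open>X ** A = Y ** A\<close>. Then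
  \<open>X = X ** A ** X = Y ** A ** Y = Y\<close>.\<close>

lemma is_mp_inverse_unique:
  assumes X: "is_mp_inverse A X" and Y: "is_mp_inverse A Y"
  shows "X = Y"
proof -
  have left: "A ** X = A ** Y"
  proof -
    have "A ** X = (A ** Y) ** (A ** X)"
      using Y by (simp add: is_mp_inverse_def matrix_mul_assoc)
    also have "\<dots> = transpose ((A ** X) ** (A ** Y))"
      using X Y by (simp add: is_mp_inverse_def matrix_transpose_mul)
    also have "\<dots> = A ** Y"
      using X Y by (simp add: is_mp_inverse_def matrix_mul_assoc)
    finally show ?thesis .
  qed
  have right: "X ** A = Y ** A"
  proof -
    have "X ** A = (X ** A) ** (Y ** A)"
      using Y by (simp add: is_mp_inverse_def flip: matrix_mul_assoc)
    also have "\<dots> = transpose ((Y ** A) ** (X ** A))"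
      using X Y by (simp add: is_mp_inverse_def matrix_transpose_mul)
    also have "(Y ** A) ** (X ** A) = Y ** A"
      using X by (simp add: is_mp_inverse_def flip: matrix_mul_assoc)
    finally show ?thesis
      using Y by (simp add: is_mp_inverse_def)
  qed
  have "X = X ** A ** X" "Y = Y ** A ** Y"
    using X Y by (simp_all add: is_mp_inverse_def)
  have "X = Y ** (A ** X)"
    using \<open>X = X ** A ** X\<close> by (simp only: right matrix_mul_assoc)
  then show ?thesis
    using \<open>Y = Y ** A ** Y\<close> by (simp only: left matrix_mul_assoc)
qed

text \<open>Combine inner inverses \<open>Y\<close> with \<open>A ** Y\<close> symmetric and
  \<open>W\<close> with \<open>W ** A\<close> symmetric: \<open>W ** A ** Y\<close> inherits both
  symmetries. \<open>W\<close> comes from the least-squares construction for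
  \<open>transpose A\<close>.\<close>

lemma is_mp_inverse_mp_inverse: "is_mp_inverse A (mp_inverse A)"
proof -
  obtain Y where Y: "A ** Y ** A = A" "transpose (A ** Y) = A ** Y"
    by (rule least_squares_inverse_exists)
  obtain Z where Z: "transpose A ** Z ** transpose A = transpose A"
    "transpose (transpose A ** Z) = transpose A ** Z"
    by (rule least_squares_inverse_exists)
  define W where "W = transpose Z"
  have W: "A ** W ** A = A" "transpose (W ** A) = W ** A"
    using arg_cong[OF Z(1), of transpose] arg_cong[OF Z(2), of transpose] 
    by (simp_all add: W_def matrix_transpose_mul matrix_mul_assoc)
  have left: "A ** (W ** A ** Y) = A ** Y"
    by (simp add: matrix_mul_assoc W)
  have right: "W ** A ** Y ** A = W ** A"
    using Y(1) by (simp flip: matrix_mul_assoc)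
  have "W ** A ** (W ** A ** Y) = W ** A ** Y"
    using left by (simp flip: matrix_mul_assoc)
  then have "is_mp_inverse A (W ** A ** Y)"
    unfolding is_mp_inverse_def left right using W Y by simp
  then show ?thesis
    unfolding mp_inverse_def by (metis is_mp_inverse_unique theI)
qed

lemma mp_inverse_props:
  shows "A ** mp_inverse A ** A = A" and "mp_inverse A ** A ** mp_inverse A = mp_inverse A"
    and "transpose (A ** mp_inverse A) = A ** mp_inverse A"
  using is_mp_inverse_mp_inverse[of A] by (simp_all add: is_mp_inverse_def)

lemma mp_inverse_range_subset:
  assumes "range (\<lambda>x. M *v x) \<subseteq> range (\<lambda>x. A *v x)"
  shows "A ** mp_inverse A ** M = M"
proof -
  have "A *v (mp_inverse A *v (M *v x)) = M *v x" for x
  proof -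
    obtain y where "M *v x = A *v y"
      using assms by blast
    then show ?thesis
      by (simp add: matrix_vector_mul_assoc matrix_mul_assoc mp_inverse_props)
  qed
  then show ?thesis
    by (simp add: matrix_eq flip: matrix_vector_mul_assoc)
qed

text \<open>Projections \<open>?P\<close>, \<open>?Q\<close> onto a common range satisfy
  \<open>?P ** ?Q = ?Q\<close> and \<open>?Q ** ?P = ?P\<close>; symmetry and transposition identify
  them.\<close>

lemma mp_inverse_range_eq:
  fixes A M :: "real^'n^'m"
  assumes "range (\<lambda>x. A *v x) = range (\<lambda>x. M *v x)"
  shows "A ** mp_inverse A = M ** mp_inverse M"
proof -
  let ?P = "A ** mp_inverse A" and ?Q = "M ** mp_inverse M"
  have "?P ** ?Q = ?Q" "?Q ** ?P = ?P"
    using mp_inverse_range_subset[of M A] mp_inverse_range_subset[of A M] assms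
    by (simp_all add: matrix_mul_assoc)
  then have "?P = transpose (?Q ** ?P)"
    by (simp add: mp_inverse_props)
  also have "\<dots> = ?P ** ?Q"
    unfolding matrix_transpose_mul[of ?Q ?P] by (simp only: mp_inverse_props)
  finally show ?thesis
    using \<open>?P ** ?Q = ?Q\<close> by simp
qed

subsection \<open>Splittings\<close>

text \<open>Equal null spaces give \<open>N ** (mp_inverse M ** M) = N\<close>, equal ranges give
  \<open>mp_inverse M ** (A ** mp_inverse A) = mp_inverse M\<close>. So with
  \<open>T = N ** mp_inverse M\<close> and \<open>G = N ** mp_inverse A\<close>,
  \<open>T ** G = G - T\<close>, and the expansion collapses to 1.\<close>

lemma proper_splitting_resolvent:
  fixes A M N :: "real^'n^'n"
  assumes "proper_splitting A M N"
  shows "(mat 1 - N ** mp_inverse M) ** (mat 1 + N ** mp_inverse A) = mat 1"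
proof -
  have A: "A = M - N" and range: "range (\<lambda>x. A *v x) = range (\<lambda>x. M *v x)"
    and null: "{x. A *v x = 0} = {x. M *v x = 0}"
    using assms by (auto simp: proper_splitting_def)
  have N: "N = M - A"
    by (simp add: A)
  have NMM: "N ** (mp_inverse M ** M) = N"
  proof -
    have "N *v (mp_inverse M *v (M *v x)) = N *v x" for x
    proof -
      \<comment> \<open>This difference lies in the common null space of \<open>M\<close> and
        \<open>A\<close>, so \<open>N = M - A\<close> kills it.\<close>
      let ?y = "mp_inverse M *v (M *v x) - x"
      have "M *v ?y = 0"
        by (simp add: matrix_vector_mult_diff_distrib matrix_vector_mul_assoc matrix_mul_assoc mp_inverse_props)
      moreover from this have "A *v ?y = 0"
        using null by blast
      ultimately have "N *v ?y = 0"
        unfolding N matrix_vector_mult_diff_rdistrib by simp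
      then show ?thesis
        by (simp add: matrix_vector_mult_diff_distrib)
    qed
    then show ?thesis
      by (simp add: matrix_eq flip: matrix_vector_mul_assoc)
  qed
  have MNA: "mp_inverse M ** N ** mp_inverse A = mp_inverse M ** M ** mp_inverse A - mp_inverse M"
  proof -
    have "mp_inverse M ** (A ** mp_inverse A) = mp_inverse M"
      by (simp add: mp_inverse_range_eq[OF range] mp_inverse_props matrix_mul_assoc)
    then show ?thesis
      by (simp add: N matrix_diff_ldistrib matrix_diff_rdistrib matrix_mul_assoc)
  qed
  have "N ** mp_inverse M ** (N ** mp_inverse A) = N ** (mp_inverse M ** N ** mp_inverse A)"
    by (simp add: matrix_mul_assoc)
  also have "\<dots> = N ** (mp_inverse M ** M) ** mp_inverse A - N ** mp_inverse M"
    by (simp add: MNA matrix_diff_ldistrib matrix_mul_assoc)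
  also have "\<dots> = N ** mp_inverse A - N ** mp_inverse M"
    by (simp only: NMM)
  finally show ?thesis
    by (simp add: matrix_diff_rdistrib matrix_add_ldistrib)
qed

text \<open>The two factors are \<open>B ** matrix_inv U\<close> and
  \<open>U ** matrix_inv B\<close>, inverse to each other.\<close>

lemma weak_splitting_2_resolvent:
  fixes B U V :: "real^'n^'n"
  assumes "weak_splitting_2 B U V"
  shows "(mat 1 - V ** matrix_inv U) ** (mat 1 + V ** matrix_inv B) = mat 1"
proof -
  have inv: "B ** matrix_inv B = mat 1" "matrix_inv U ** U = mat 1" "U ** matrix_inv U = mat 1"
    and B: "B = U - V"
    using assms matrix_inv_mult[of B] matrix_inv_mult[of U] by (auto simp: weak_splitting_2_def)
  have "mat 1 - V ** matrix_inv U = B ** matrix_inv U"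
    by (simp add: B matrix_diff_rdistrib inv)
  moreover have "mat 1 + V ** matrix_inv B = U ** matrix_inv B"
  proof -
    have "U ** matrix_inv B = (B + V) ** matrix_inv B"
      by (simp add: B)
    then show ?thesis
      by (simp add: matrix_add_rdistrib inv)
  qed
  ultimately show ?thesis
    by (metis inv matrix_mul_assoc matrix_mul_lid)
qed

theorem theorem3p3:
  fixes A M N L :: "real^'n^'n"
    and M\<^sub>l N\<^sub>l :: "real \<Rightarrow> real^'n^'n"
  assumes singular: "\<not> invertible A"
    and splitting: "weak_proper_splitting_2 A M N"
    and splitting_l: "\<And>l. l > 0 \<Longrightarrow> weak_splitting_2 (shifted_gram A l) (M\<^sub>l l) (N\<^sub>l l)"
    and lim: "((\<lambda>l. N\<^sub>l l ** matrix_inv (shifted_gram A l)) \<longlongrightarrow> L) (at_right 0)"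
    and L_le: "L \<le> N ** mp_inverse A"
    and L_nonneg: "0 \<le> L"
  shows "(\<exists>r. ((\<lambda>l. spec_radius (matrix_inv (M\<^sub>l l) ** N\<^sub>l l)) \<longlongrightarrow> r) (at_right 0) \<and>
              r \<le> spec_radius (mp_inverse M ** N)) \<and>
         spec_radius (mp_inverse M ** N) < 1"
proof -
  let ?T = "N ** mp_inverse M" and ?G = "N ** mp_inverse A"
  let ?T\<^sub>l = "\<lambda>l. N\<^sub>l l ** matrix_inv (M\<^sub>l l)"
  have T: "0 \<le> ?T" "(mat 1 - ?T) ** (mat 1 + ?G) = mat 1"
    using splitting proper_splitting_resolvent by (auto simp: weak_proper_splitting_2_def)
  have "\<forall>\<^sub>F l in at_right 0. 0 \<le> ?T\<^sub>l l \<and>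
      (mat 1 - ?T\<^sub>l l) ** (mat 1 + N\<^sub>l l ** matrix_inv (shifted_gram A l)) = mat 1"
    using eventually_at_right_less
  proof eventually_elim
    case (elim l)
    then show ?case
      using splitting_l[OF elim] weak_splitting_2_resolvent[OF splitting_l[OF elim]]
      by (simp add: weak_splitting_2_def)
  qed
  then obtain T\<^sub>0 where T\<^sub>0: "(?T\<^sub>l \<longlongrightarrow> T\<^sub>0) (at_right 0)" "0 \<le> T\<^sub>0" "(mat 1 - T\<^sub>0) ** (mat 1 + L) = mat 1"
    using tendsto_one_minus_inverse[OF _ lim L_nonneg, of ?T\<^sub>l] trivial_limit_at_right_real by blast
  \<comment> \<open>The required limit is \<open>spec_radius T\<^sub>0\<close>: continuity handles
    the products in reversed order, and exchanging the factors keeps the spectral radius.\<close>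
  have "((\<lambda>l. spec_radius (matrix_inv (M\<^sub>l l) ** N\<^sub>l l)) \<longlongrightarrow> spec_radius T\<^sub>0) (at_right 0)"
    using tendsto_spec_radius[OF T\<^sub>0(1)]
    unfolding spec_radius_mult_commute[of "matrix_inv (M\<^sub>l _)"] .
  moreover have "spec_radius T\<^sub>0 \<le> spec_radius ?T"
    by (rule spec_radius_mono_resolvent[OF T\<^sub>0(2) L_nonneg L_le T\<^sub>0(3) T(2)])
  \<comment> \<open>Nonnegativity of \<open>?G\<close> comes from
    \<open>0 \<le> L \<le> ?G\<close>.\<close>
  moreover have "spec_radius ?T < 1"
    by (rule spec_radius_less_one[OF T(1) order_trans[OF L_nonneg L_le] T(2)])
  ultimately show ?thesis
    unfolding spec_radius_mult_commute[of "mp_inverse M" N] by blast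
qed

end
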